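(* Let $n \geq 1$ and let $H_1, \dots, H_n \subset \mathbb{R}^2$ be closed unit squares (side length $1$), each with its edges parallel to the coordinate axes. Let $\mathcal{H} = \bigcup_{i=1}^n H_i$. Then $$\frac{p(\mathcal{H})}{a(\mathcal{H})} \leq 4,$$ where $p(\mathcal{H})$ is the perimeter of $\mathcal{H}$ and $a(\mathcal{H})$ is the area of $\mathcal{H}$.
   Context: Squares are filled (closed two-dimensional regions). For a closed, bounded polygonal figure $A \subset \mathbb{R}^2$, $p(A)$ denotes its perimeter (the total length of the boundary $\partial A$) and $a(A)$ denotes its area. *)

theory Defs
  imports "HOL-Analysis.Analysis"
begin

text \<open>
  Length is the one-dimensional Hausdorff measure, normalised so that a segment has its usual
  length (lemma \<open>hausdorff_length_closed_segment\<close>). Covering sets are required to be bounded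
  because \<open>diameter\<close> is unspecified on unbounded sets; in a product such as \<open>real \<times> real\<close> the
  metric is the Euclidean one.
\<close>

definition hausdorff_length_pre :: "real \<Rightarrow> 'a::metric_space set \<Rightarrow> ennreal" where
  "hausdorff_length_pre \<delta> A =
     (INF U \<in> {U :: nat \<Rightarrow> 'a set. A \<subseteq> (\<Union>i. U i) \<and> (\<forall>i. bounded (U i) \<and> diameter (U i) \<le> \<delta>)}.
        \<Sum>i. ennreal (diameter (U i)))"

definition hausdorff_length :: "'a::metric_space set \<Rightarrow> ennreal" where
  "hausdorff_length A = (SUP \<delta>\<in>{0<..}. hausdorff_length_pre \<delta> A)"

definition perimeter :: "(real \<times> real) set \<Rightarrow> ennreal" where
  "perimeter A = hausdorff_length (frontier A)"

definition area :: "(real \<times> real) set \<Rightarrow> ennreal" where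
  "area A = emeasure lebesgue A"

definition axis_parallel_unit_square :: "(real \<times> real) set \<Rightarrow> bool" where
  "axis_parallel_unit_square S \<longleftrightarrow> (\<exists>a b. S = {a..a + 1} \<times> {b..b + 1})"

lemma hausdorff_length_closed_segment:
  fixes a b :: "'a::euclidean_space"
  shows "hausdorff_length (closed_segment a b) = ennreal (dist a b)"
proof (rule antisym)
  let ?L = "dist a b"
  show "hausdorff_length (closed_segment a b) \<le> ennreal ?L"
    unfolding hausdorff_length_def
  proof (rule SUP_least)
    fix \<delta> :: real assume "\<delta> \<in> {0<..}"
    then have d: "\<delta> > 0" by simp
    obtain N where N: "N > 0" "?L / real N \<le> \<delta>"
    proof -
      obtain m where "?L / \<delta> < real m" using reals_Archimedean2 by blast
      then have "?L / real (Suc m) \<le> \<delta>" using d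
        by (simp add: field_simps)
      then show ?thesis using that[of "Suc m"] by simp
    qed
    define g where "g t = a + t *\<^sub>R (b - a)" for t :: real
    define U where "U i = (if i < N then g ` {real i / real N..(real i + 1) / real N} else {})" for i :: nat
    have diam: "diameter (U i) \<le> (if i < N then ?L / real N else 0)" for i
    proof (cases "i < N")
      case True
      have "norm (x - y) \<le> ?L / real N" if xy: "x \<in> U i" "y \<in> U i" for x y
      proof -
        obtain s t where st: "x = g s" "y = g t" "s \<in> {real i / real N..(real i + 1) / real N}"
          "t \<in> {real i / real N..(real i + 1) / real N}"
          using xy True by (auto simp: U_def)
        have "\<bar>s - t\<bar> \<le> (real i + 1) / real N - real i / real N" using st by auto
        also have "\<dots> = 1 / real N" by (simp add: diff_divide_distrib [symmetric])
        finally have *: "\<bar>s - t\<bar> \<le> 1 / real N" .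
        have "x - y = (s - t) *\<^sub>R (b - a)" by (simp add: st g_def algebra_simps)
        then have "norm (x - y) = \<bar>s - t\<bar> * ?L" by (simp add: dist_norm norm_minus_commute)
        also have "\<dots> \<le> 1 / real N * ?L" using * by (intro mult_right_mono) auto
        finally show ?thesis by simp
      qed
      then show ?thesis using True by (simp add: diameter_le)
    qed (simp add: U_def)
    have bdd: "bounded (U i)" for i
      unfolding U_def g_def
      by (auto intro!: compact_imp_bounded compact_continuous_image continuous_intros)
    have cover: "closed_segment a b \<subseteq> (\<Union>i. U i)"
    proof
      fix x assume "x \<in> closed_segment a b"
      then obtain t where t: "0 \<le> t" "t \<le> 1" "x = g t"
        by (auto simp: closed_segment_def g_def algebra_simps)
      show "x \<in> (\<Union>i. U i)"
      proof (cases "t = 1")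
        case True
        then have "x \<in> U (N - 1)" using t N by (auto simp: U_def of_nat_diff field_simps)
        then show ?thesis by blast
      next
        case False
        define i where "i = nat \<lfloor>t * real N\<rfloor>"
        have i: "real i \<le> t * real N" "t * real N < real i + 1"
          using t by (auto simp: i_def)
        moreover have "t * real N < real N" using False t N by simp
        ultimately have "i < N" by linarith
        then have "x \<in> U i" using i N t(3) by (auto simp: U_def field_simps intro!: imageI)
        then show ?thesis by blast
      qed
    qed
    have "hausdorff_length_pre \<delta> (closed_segment a b) \<le> (\<Sum>i. ennreal (diameter (U i)))"
      unfolding hausdorff_length_pre_def
    proof (rule INF_lower, safe)
      fix i show "diameter (U i) \<le> \<delta>" using diam[of i] N d by (auto split: if_splits)
    qed (use cover bdd in auto)
    also have "\<dots> = (\<Sum>i<N. ennreal (diameter (U i)))"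
      by (rule suminf_finite) (auto simp: U_def)
    also have "\<dots> \<le> (\<Sum>i<N. ennreal (?L / real N))"
      using diam by (intro sum_mono ennreal_leI) (metis lessThan_iff)
    also have "\<dots> = ennreal ?L"
      using N by (simp add: sum_ennreal del: sum_constant) simp
    finally show "hausdorff_length_pre \<delta> (closed_segment a b) \<le> ennreal ?L" .
  qed
next
  let ?L = "dist a b"
  have "ennreal ?L \<le> hausdorff_length_pre 1 (closed_segment a b)"
    unfolding hausdorff_length_pre_def
  proof (rule INF_greatest, clarify)
    fix U :: "nat \<Rightarrow> 'a set"
    assume cov: "closed_segment a b \<subseteq> (\<Union>i. U i)"
      and U: "\<forall>i. bounded (U i) \<and> diameter (U i) \<le> 1"
    let ?f = "\<lambda>x. dist x a"
    define V where "V i = (if U i = {} then {} else {Inf (?f ` U i)..Sup (?f ` U i)})" for i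
    have bf: "bdd_below (?f ` U i)" "bdd_above (?f ` U i)" for i
    proof -
      show "bdd_below (?f ` U i)" by (rule bdd_belowI2[of _ 0]) simp
      obtain e where "\<forall>y\<in>U i. dist a y \<le> e"
        using U bounded_any_center[of "U i" a] by blast
      then show "bdd_above (?f ` U i)" by (intro bdd_aboveI2[of _ _ e]) (simp add: dist_commute)
    qed
    have sub: "?f ` U i \<subseteq> V i" for i
      using bf[of i] by (auto simp: V_def intro!: cINF_lower cSUP_upper)
    have len: "emeasure lborel (V i) \<le> ennreal (diameter (U i))" for i
    proof (cases "U i = {}")
      case False
      have 1: "?f x \<le> diameter (U i) + ?f y" if "x \<in> U i" "y \<in> U i" for x y
        using diameter_bounded_bound[of "U i" x y] U that dist_triangle[of x a y] by auto
      have "Sup (?f ` U i) - diameter (U i) \<le> Inf (?f ` U i)"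
      proof (rule cInf_greatest)
        fix z assume "z \<in> ?f ` U i"
        then obtain y where y: "y \<in> U i" "z = ?f y" by auto
        have "Sup (?f ` U i) \<le> diameter (U i) + z"
          using False 1 y by (intro cSup_least) auto
        then show "Sup (?f ` U i) - diameter (U i) \<le> z" by simp
      qed (use False in auto)
      moreover have "Inf (?f ` U i) \<le> Sup (?f ` U i)"
        using False bf by (intro cInf_le_cSup) auto
      ultimately show ?thesis using False by (simp add: V_def ennreal_leI)
    qed (simp add: V_def)
    have "{0..?L} \<subseteq> (\<Union>i. V i)"
    proof
      fix t assume t: "t \<in> {0..?L}"
      define x where "x = a + (t / ?L) *\<^sub>R (b - a)"
      have "x \<in> closed_segment a b"
        unfolding in_segment
      proof (intro exI conjI)
        show "x = (1 - t / ?L) *\<^sub>R a + (t / ?L) *\<^sub>R b"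
          by (simp add: x_def scaleR_diff_left scaleR_diff_right)
      qed (use t in \<open>auto simp: divide_le_eq_1\<close>)
      moreover have "?f x = t" using t
        by (cases "a = b") (auto simp: x_def dist_norm norm_minus_commute)
      ultimately show "t \<in> (\<Union>i. V i)" using cov sub by blast
    qed
    then have "emeasure lborel {0..?L} \<le> emeasure lborel (\<Union>i. V i)"
      by (intro emeasure_mono) (auto simp: V_def)
    also have "\<dots> \<le> (\<Sum>i. emeasure lborel (V i))"
      by (intro emeasure_subadditive_countably) (auto simp: V_def)
    also have "\<dots> \<le> (\<Sum>i. ennreal (diameter (U i)))"
      by (intro suminf_le len) auto
    finally show "ennreal ?L \<le> (\<Sum>i. ennreal (diameter (U i)))" by simp
  qed
  also have "\<dots> \<le> hausdorff_length (closed_segment a b)"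
    unfolding hausdorff_length_def by (rule SUP_upper) simp
  finally show "ennreal ?L \<le> hausdorff_length (closed_segment a b)" .
qed

end

theory Submission imports Defs begin

text \<open>
  The boundary of a finite union \<open>U\<close> of axis-parallel unit squares consists of horizontal and
  vertical segments, and each of the two kinds has total length at most \<open>2 * area U\<close>.

  For the horizontal part, cut \<open>U\<close> by the vertical line at \<open>x\<close>. The slice is a finite union of
  closed unit intervals, so each of its components has length at least 1 and exactly two end
  points; hence the slice has at most twice as many frontier points as its length
  (\<open>frontier_unit_intervals\<close>). For all but finitely many \<open>x\<close>, a frontier point of \<open>U\<close> above \<open>x\<close> is
  a frontier point of the slice (\<open>frontier_slice\<close>). Integrating over \<open>x\<close>, the number of
  horizontal boundary points above \<open>x\<close> integrates to the length of the horizontal boundary, while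
  the length of the slice integrates to the area (\<open>horizontal_edges_le\<close>). Reflection in the
  diagonal exchanges the two directions (\<open>vertical_edges_le\<close>).

  Only upper bounds for the Hausdorff length are involved: it is subadditive, nonexpansive maps
  do not increase it, and on compact subsets of the line it is bounded by Lebesgue measure.
\<close>

section \<open>Upper bounds for Hausdorff length\<close>

lemma hausdorff_length_pre_le:
  assumes "A \<subseteq> (\<Union>i. U i)" "\<And>i. bounded (U i)" "\<And>i. diameter (U i) \<le> \<delta>"
  shows "hausdorff_length_pre \<delta> A \<le> (\<Sum>i. ennreal (diameter (U i)))"
  unfolding hausdorff_length_pre_def using assms by (intro INF_lower) auto

lemma hausdorff_length_empty [simp]: "hausdorff_length {} = 0"
proof -
  have "hausdorff_length_pre \<delta> {} \<le> 0" if "\<delta> > 0" for \<delta> :: real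
    using hausdorff_length_pre_le[of "{}" "\<lambda>_. {}" \<delta>] that by simp
  then have "hausdorff_length {} \<le> (0::ennreal)"
    unfolding hausdorff_length_def by (intro SUP_least) auto
  then show ?thesis by simp
qed

text \<open>
  Merging a cover of \<open>A\<close> with a cover of \<open>B\<close> covers the union. The infima over the two covers are
  then taken one after the other by moving one summand to the other side; since subtraction of
  \<open>\<infinity>\<close> carries no information, an infinite summand is treated separately.
\<close>

lemma hausdorff_length_pre_Un_le:
  "hausdorff_length_pre \<delta> (A \<union> B) \<le> hausdorff_length_pre \<delta> A + hausdorff_length_pre \<delta> B"
proof -
  let ?C = "\<lambda>A. {U :: nat \<Rightarrow> _ set. A \<subseteq> (\<Union>i. U i) \<and> (\<forall>i. bounded (U i) \<and> diameter (U i) \<le> \<delta>)}"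
  let ?s = "\<lambda>U. \<Sum>i. ennreal (diameter (U (i::nat)))"
  have interleave: "hausdorff_length_pre \<delta> (A \<union> B) \<le> ?s U + ?s V"
    if U: "U \<in> ?C A" and V: "V \<in> ?C B" for U V
  proof -
    \<comment> \<open>Alternate the two covers, so that even partial sums split into partial sums of both.\<close>
    define W where "W i = (if even i then U (i div 2) else V (i div 2))" for i
    have WU: "W (2 * i) = U i" and WV: "W (Suc (2 * i)) = V i" for i
      by (auto simp: W_def)
    have part: "(\<Sum>i<2*n. ennreal (diameter (W i))) =
        (\<Sum>i<n. ennreal (diameter (U i))) + (\<Sum>i<n. ennreal (diameter (V i)))" for n
      by (induction n) (simp_all add: WU WV add_ac)
    have "A \<subseteq> (\<Union>i. W i)" "B \<subseteq> (\<Union>i. W i)"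
      using U V by (fastforce simp flip: WU, fastforce simp flip: WV)
    then have "hausdorff_length_pre \<delta> (A \<union> B) \<le> ?s W"
      using U V by (intro hausdorff_length_pre_le) (auto simp: W_def)
    also have "\<dots> \<le> ?s U + ?s V"
    proof (rule suminf_le_const)
      fix n
      have "(\<Sum>i<n. ennreal (diameter (W i))) \<le> (\<Sum>i<2*n. ennreal (diameter (W i)))"
        by (intro sum_mono2) auto
      also have "\<dots> \<le> ?s U + ?s V"
        unfolding part by (intro add_mono sum_le_suminf) auto
      finally show "(\<Sum>i<n. ennreal (diameter (W i))) \<le> ?s U + ?s V" .
    qed auto
    finally show ?thesis .
  qed
  have one: "hausdorff_length_pre \<delta> (A \<union> B) \<le> ?s U + hausdorff_length_pre \<delta> B"
    if U: "U \<in> ?C A" for U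
  proof (cases "?s U = top")
    case False
    have "hausdorff_length_pre \<delta> (A \<union> B) - ?s U \<le> hausdorff_length_pre \<delta> B"
      unfolding hausdorff_length_pre_def [of \<delta> B]
    proof (rule INF_greatest)
      fix V assume "V \<in> ?C B"
      then show "hausdorff_length_pre \<delta> (A \<union> B) - ?s U \<le> ?s V"
        using interleave[OF U] False by (simp add: ennreal_minus_le_iff)
    qed
    then show ?thesis using False by (simp add: ennreal_minus_le_iff)
  qed simp
  show ?thesis
  proof (cases "hausdorff_length_pre \<delta> B = top")
    case False
    have "hausdorff_length_pre \<delta> (A \<union> B) - hausdorff_length_pre \<delta> B \<le> hausdorff_length_pre \<delta> A"
      unfolding hausdorff_length_pre_def [of \<delta> A]
    proof (rule INF_greatest)
      fix U assume "U \<in> ?C A"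
      then show "hausdorff_length_pre \<delta> (A \<union> B) - hausdorff_length_pre \<delta> B \<le> ?s U"
        using one[of U] False by (simp add: ennreal_minus_le_iff add.commute)
    qed
    then show ?thesis using False by (simp add: ennreal_minus_le_iff add.commute)
  qed simp
qed

lemma hausdorff_length_Un_le:
  "hausdorff_length (A \<union> B) \<le> hausdorff_length A + hausdorff_length B"
proof -
  have "hausdorff_length_pre \<delta> (A \<union> B) \<le> hausdorff_length A + hausdorff_length B"
    if "\<delta> \<in> {0<..}" for \<delta>
  proof -
    have "hausdorff_length_pre \<delta> C \<le> hausdorff_length C" for C :: "'a set"
      unfolding hausdorff_length_def using that by (rule SUP_upper)
    then show ?thesis
      by (meson hausdorff_length_pre_Un_le add_mono order_trans)
  qed
  then show ?thesis
    unfolding hausdorff_length_def [of "A \<union> B"] by (rule SUP_least)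
qed

lemma hausdorff_length_UN_le:
  "finite I \<Longrightarrow> hausdorff_length (\<Union>i\<in>I. A i) \<le> (\<Sum>i\<in>I. hausdorff_length (A i))"
proof (induction I rule: finite_induct)
  case (insert i I)
  have "hausdorff_length (\<Union>j\<in>insert i I. A j) \<le> hausdorff_length (A i) + hausdorff_length (\<Union>j\<in>I. A j)"
    using hausdorff_length_Un_le by simp
  also have "\<dots> \<le> hausdorff_length (A i) + (\<Sum>j\<in>I. hausdorff_length (A j))"
    using insert by (intro add_left_mono) auto
  finally show ?case using insert by simp
qed simp

lemma hausdorff_length_mono:
  assumes "A \<subseteq> B"
  shows "hausdorff_length A \<le> hausdorff_length B"
  unfolding hausdorff_length_def hausdorff_length_pre_def
  using assms by (intro SUP_mono' INF_superset_mono) auto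

lemma hausdorff_length_nonexpansive_image_le:
  fixes f :: "'a::metric_space \<Rightarrow> 'b::metric_space"
  assumes f: "\<And>x y. dist (f x) (f y) \<le> dist x y"
  shows "hausdorff_length (f ` A) \<le> hausdorff_length A"
proof -
  have image: "bounded (f ` S) \<and> diameter (f ` S) \<le> diameter S" if S: "bounded S" for S
  proof
    obtain x e where "\<forall>y\<in>S. dist x y \<le> e" using S unfolding bounded_def by blast
    then have "\<forall>z\<in>f ` S. dist (f x) z \<le> e" using f order_trans by blast
    then show "bounded (f ` S)" unfolding bounded_def by blast
    show "diameter (f ` S) \<le> diameter S"
    proof (cases "S = {}")
      case False
      have "dist (f x) (f y) \<le> diameter S" if "x \<in> S" "y \<in> S" for x y
        using f[of x y] diameter_bounded_bound[OF S that] by linarith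
      then show ?thesis
        using False unfolding diameter_def [of "f ` S"] by (auto intro!: cSUP_least)
    qed simp
  qed
  have "hausdorff_length_pre \<delta> (f ` A) \<le> hausdorff_length_pre \<delta> A" for \<delta>
    unfolding hausdorff_length_pre_def [of \<delta> A]
  proof (rule INF_greatest, clarify)
    fix U :: "nat \<Rightarrow> 'a set"
    assume U: "A \<subseteq> (\<Union>i. U i)" "\<forall>i. bounded (U i) \<and> diameter (U i) \<le> \<delta>"
    have "hausdorff_length_pre \<delta> (f ` A) \<le> (\<Sum>i. ennreal (diameter (f ` U i)))"
    proof (intro hausdorff_length_pre_le)
      show "f ` A \<subseteq> (\<Union>i. f ` U i)" using U(1) by (auto simp flip: image_UN)
      show "bounded (f ` U i)" for i using U(2) image by simp
      show "diameter (f ` U i) \<le> \<delta>" for i using U(2) image[of "U i"] by (meson order_trans)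
    qed
    also have "\<dots> \<le> (\<Sum>i. ennreal (diameter (U i)))"
      using U(2) image by (intro suminf_le ennreal_leI) simp_all
    finally show "hausdorff_length_pre \<delta> (f ` A) \<le> (\<Sum>i. ennreal (diameter (U i)))" .
  qed
  then show ?thesis
    unfolding hausdorff_length_def by (intro SUP_mono') auto
qed

text \<open>
  By outer regularity and compactness, some \<open>e\<close>-neighbourhood of \<open>S\<close> has measure at most
  \<open>\<epsilon>\<close> more than \<open>S\<close>. The cells of a grid of mesh less than \<open>e\<close> that meet \<open>S\<close> are disjoint and lie in this
  neighbourhood, and they form a cover of \<open>S\<close> whose diameters add up to their measure.
\<close>

lemma hausdorff_length_le_lborel:
  fixes S :: "real set"
  assumes S: "compact S"
  shows "hausdorff_length S \<le> emeasure lborel S"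
  unfolding hausdorff_length_def
proof (rule SUP_least, rule ennreal_le_epsilon)
  fix \<delta> \<epsilon> :: real
  assume "\<delta> \<in> {0<..}" and \<epsilon>: "\<epsilon> > 0"
  then have \<delta>: "\<delta> > 0" by simp
  obtain T where T: "open T" "S \<subseteq> T" "emeasure lborel T \<le> emeasure lborel S + ennreal \<epsilon>"
  proof -
    have borel: "S \<in> sets borel" using S by (rule borel_compact)
    then obtain T where T: "open T" "S \<subseteq> T" "emeasure lborel (T - S) < ennreal \<epsilon>"
      using outer_regular_lborel[OF _ \<epsilon>] by metis
    have "emeasure lborel T = emeasure lborel S + emeasure lborel (T - S)"
      using T borel by (subst plus_emeasure) (auto simp: Un_absorb1)
    then show thesis using that[OF T(1,2)] T(3) by (simp add: add_left_mono less_imp_le)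
  qed
  obtain e where e: "e > 0" "(\<Union>x\<in>S. ball x e) \<subseteq> T"
    using compact_subset_open_imp_ball_epsilon_subset[OF S T(1,2)] by blast
  define h where "h = min \<delta> e / 2"
  have h: "h > 0" "h < e" "h \<le> \<delta>" using \<delta> e by (auto simp: h_def)
  define cell where "cell k = {of_int k * h..<(of_int k + 1) * h}" for k :: int
  have in_cell: "x \<in> cell k \<longleftrightarrow> \<lfloor>x / h\<rfloor> = k" for x k
    using h by (simp add: cell_def floor_eq_iff pos_le_divide_eq pos_divide_less_eq)
  define K where "K = (\<lambda>x. \<lfloor>x / h\<rfloor>) ` S"
  have finK: "finite K"
  proof -
    obtain B where B: "\<And>x. x \<in> S \<Longrightarrow> \<bar>x\<bar> \<le> B"
      using compact_imp_bounded[OF S] unfolding bounded_iff by auto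
    have "K \<subseteq> {\<lfloor>(- B) / h\<rfloor>..\<lfloor>B / h\<rfloor>}"
      unfolding K_def
    proof (rule image_subsetI)
      fix x assume "x \<in> S"
      then have "- B \<le> x" "x \<le> B" using B[of x] by auto
      then show "\<lfloor>x / h\<rfloor> \<in> {\<lfloor>(- B) / h\<rfloor>..\<lfloor>B / h\<rfloor>}"
        unfolding atLeastAtMost_iff using h
        by (intro conjI floor_mono divide_right_mono) auto
    qed
    then show ?thesis by (rule finite_subset) simp
  qed
  have diam: "bounded (cell k)" "diameter (cell k) \<le> h" for k
    using h by (auto simp: cell_def bounded_Ico algebra_simps intro!: diameter_le)
  have "hausdorff_length_pre \<delta> S \<le> of_nat (card K) * ennreal h"
  proof -
    obtain g where g: "bij_betw g {..<card K} K"
      using finK ex_bij_betw_nat_finite[OF finK] by (auto simp: atLeast0LessThan)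
    define U where "U i = (if i < card K then cell (g i) else {})" for i
    have "S \<subseteq> (\<Union>i. U i)"
    proof
      fix x assume "x \<in> S"
      then have "\<lfloor>x / h\<rfloor> \<in> K" by (simp add: K_def)
      then obtain i where "i < card K" "g i = \<lfloor>x / h\<rfloor>"
        using g by (metis bij_betw_iff_bijections lessThan_iff)
      then show "x \<in> (\<Union>i. U i)" by (auto simp: U_def in_cell)
    qed
    moreover have "diameter (U i) \<le> \<delta>" for i
      using diam(2)[of "g i"] h \<delta> by (simp add: U_def)
    moreover have "bounded (U i)" for i
      using diam by (simp add: U_def)
    ultimately have "hausdorff_length_pre \<delta> S \<le> (\<Sum>i. ennreal (diameter (U i)))"
      by (intro hausdorff_length_pre_le)
    also have "\<dots> = (\<Sum>i<card K. ennreal (diameter (U i)))"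
      by (rule suminf_finite) (auto simp: U_def)
    also have "\<dots> \<le> (\<Sum>i<card K. ennreal h)"
      using diam by (intro sum_mono ennreal_leI) (simp add: U_def)
    finally show ?thesis by simp
  qed
  also have "\<dots> = (\<Sum>k\<in>K. emeasure lborel (cell k))"
    using h by (simp add: cell_def algebra_simps)
  also have "\<dots> = emeasure lborel (\<Union>k\<in>K. cell k)"
    using finK by (intro sum_emeasure)
      (auto simp: disjoint_family_on_def in_cell, simp add: cell_def)
  also have "\<dots> \<le> emeasure lborel T"
  proof (rule emeasure_mono)
    show "(\<Union>k\<in>K. cell k) \<subseteq> T"
    proof safe
      fix k x assume "k \<in> K" and x: "x \<in> cell k"
      then obtain s where s: "s \<in> S" "s \<in> cell k"
        by (auto simp: K_def in_cell)
      then have "dist s x < h" using x by (auto simp: cell_def dist_real_def algebra_simps)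
      then have "x \<in> ball s e" using h by simp
      then show "x \<in> T" using s(1) e(2) by blast
    qed
  qed (use T in auto)
  also note T(3)
  finally show "hausdorff_length_pre \<delta> S \<le> emeasure lborel S + ennreal \<epsilon>" .
qed

section \<open>Finite unions of unit intervals\<close>

text \<open>The half-open unit intervals that start at the points of \<open>L\<close> are disjoint and lie in \<open>V\<close>.\<close>

lemma card_unit_separated_le_emeasure:
  fixes L :: "real set"
  assumes "finite L" and V: "V \<in> sets borel"
    and sep: "\<And>y z. y \<in> L \<Longrightarrow> z \<in> L \<Longrightarrow> y < z \<Longrightarrow> y + 1 \<le> z"
    and sub: "\<And>y. y \<in> L \<Longrightarrow> {y..<y+1} \<subseteq> V"
  shows "of_nat (card L) \<le> emeasure lborel V"
proof -
  have "of_nat (card L) = (\<Sum>y\<in>L. emeasure lborel {y..<y+1})" by simp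
  also have "\<dots> = emeasure lborel (\<Union>y\<in>L. {y..<y+1})"
  proof (intro sum_emeasure)
    show "disjoint_family_on (\<lambda>y. {y..<y+1}) L"
      unfolding disjoint_family_on_def
    proof (intro ballI impI)
      fix y z assume "y \<in> L" "z \<in> L" "y \<noteq> z"
      then show "{y..<y+1} \<inter> {z..<z+1} = {}"
        using sep[of y z] sep[of z y] by (cases y z rule: linorder_cases) auto
    qed
  qed (use assms in auto)
  also have "\<dots> \<le> emeasure lborel V"
    using sub V by (intro emeasure_mono) auto
  finally show ?thesis .
qed

text \<open>
  A frontier point is an end point of one of the intervals, so \<open>V\<close> contains a unit interval
  starting there (the set \<open>L\<close>) or ending there (the set \<open>R\<close>). A point of \<open>L\<close> within
  distance less than 1 to the right of another one would lie inside the unit interval starting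
  at the latter, hence not on the frontier. So the points of \<open>L\<close> have mutual distance at
  least 1, and \<open>L\<close> has at most as many points as the length of \<open>V\<close>; likewise for \<open>R\<close>.
\<close>

lemma frontier_unit_intervals:
  fixes B :: "real set"
  assumes B: "finite B"
  defines "V \<equiv> \<Union>b\<in>B. {b..b+1}"
  shows "finite (frontier V)"
    and "of_nat (card (frontier V)) \<le> 2 * emeasure lborel V"
proof -
  have closed: "closed V" unfolding V_def using B by auto
  then have V: "V \<in> sets borel" by simp
  define L where "L = {y \<in> frontier V. {y..y+1} \<subseteq> V}"
  define R where "R = {y \<in> frontier V. {y-1..y} \<subseteq> V}"
  have not_inner: False if "y \<in> frontier V" "{c..d} \<subseteq> V" "c < y" "y < d" for c d y
    using that interior_mono[OF that(2)] by (auto simp: frontier_def)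
  have ends: "\<exists>b\<in>B. {b..b+1} \<subseteq> V \<and> (y = b \<or> y = b + 1)" if "y \<in> frontier V" for y
  proof -
    have "y \<in> V" using that closed frontier_subset_eq by blast
    then obtain b where b: "b \<in> B" "y \<in> {b..b+1}" unfolding V_def by auto
    then have "{b..b+1} \<subseteq> V" unfolding V_def by auto
    moreover from this have "\<not> (b < y \<and> y < b + 1)" using not_inner[OF that] by blast
    ultimately show ?thesis using b by (intro bexI[of _ b]) auto
  qed
  have LR: "frontier V = L \<union> R"
  proof
    show "frontier V \<subseteq> L \<union> R"
    proof
      fix y assume y: "y \<in> frontier V"
      then obtain b where "{b..b+1} \<subseteq> V" "y = b \<or> y = b + 1" using ends by blast
      then show "y \<in> L \<union> R" using y unfolding L_def R_def by auto
    qed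
  qed (auto simp: L_def R_def)
  have "frontier V \<subseteq> B \<union> (\<lambda>b. b + 1) ` B"
    using ends by blast
  then show fin: "finite (frontier V)" using B by (meson finite_Un finite_imageI finite_subset)
  have "of_nat (card L) \<le> emeasure lborel V"
  proof (rule card_unit_separated_le_emeasure)
    fix y z assume "y \<in> L" "z \<in> L" "y < z"
    then show "y + 1 \<le> z"
      using not_inner[of z y "y+1"] unfolding L_def mem_Collect_eq by (meson not_le)
  next
    fix y assume "y \<in> L"
    then show "{y..<y+1} \<subseteq> V" unfolding L_def by (simp add: subset_eq)
  qed (use V fin LR in auto)
  moreover have "of_nat (card ((\<lambda>y. y - 1) ` R)) \<le> emeasure lborel V"
  proof (rule card_unit_separated_le_emeasure)
    fix y z assume "y \<in> (\<lambda>y. y - 1) ` R" "z \<in> (\<lambda>y. y - 1) ` R" "y < z"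
    then have "y + 1 \<in> R" "z + 1 \<in> R" by auto
    then show "y + 1 \<le> z"
      using not_inner[of "y+1" z "z+1"] \<open>y < z\<close> unfolding R_def mem_Collect_eq
      by (smt (verit) add_diff_cancel_right')
  next
    fix y assume "y \<in> (\<lambda>y. y - 1) ` R"
    then have "y + 1 \<in> R" by auto
    then show "{y..<y+1} \<subseteq> V" unfolding R_def by (simp add: subset_eq)
  qed (use V fin LR in auto)
  ultimately have "of_nat (card L) + of_nat (card R) \<le> 2 * emeasure lborel V"
    by (simp add: card_image inj_on_def mult_2 add_mono)
  moreover have "of_nat (card (frontier V)) \<le> (of_nat (card L) + of_nat (card R) :: ennreal)"
    unfolding LR using card_Un_le[of L R] by (metis of_nat_add of_nat_mono)
  ultimately show "of_nat (card (frontier V)) \<le> 2 * emeasure lborel V" by order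
qed

section \<open>The boundary of a finite union of unit squares\<close>

text \<open>The squares are indexed by their lower left corners.\<close>

definition unit_squares :: "(real \<times> real) set \<Rightarrow> (real \<times> real) set" where
  "unit_squares P = (\<Union>p\<in>P. {fst p..fst p + 1} \<times> {snd p..snd p + 1})"

lemma compact_unit_squares: "finite P \<Longrightarrow> compact (unit_squares P)"
  unfolding unit_squares_def by (intro compact_UN) (auto intro!: compact_Times)

lemma Pair_vimage_unit_squares:
  "Pair x -` unit_squares P = (\<Union>b\<in>snd ` {p \<in> P. x \<in> {fst p..fst p + 1}}. {b..b+1})"
  unfolding unit_squares_def by fastforce

text \<open>
  If \<open>x\<close> is not the abscissa of a vertical side, then every square that meets the line at \<open>x\<close>
  extends to both sides of it. So \<open>U\<close> contains the product of a neighbourhood of \<open>x\<close> with the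
  slice, and an interior point of the slice is interior to \<open>U\<close>.
\<close>

lemma frontier_slice:
  assumes P: "finite P" and x: "x \<notin> fst ` P \<union> (\<lambda>p. fst p + 1) ` P"
    and xy: "(x, y) \<in> frontier (unit_squares P)"
  shows "y \<in> frontier (Pair x -` unit_squares P)"
proof -
  let ?U = "unit_squares P" and ?V = "Pair x -` unit_squares P"
  have "closed ?U" using compact_unit_squares[OF P] by (rule compact_imp_closed)
  then have y: "y \<in> ?V" using xy frontier_subset_eq by blast
  have "y \<notin> interior ?V"
  proof
    assume "y \<in> interior ?V"
    define N where "N = (\<Inter>p\<in>{p \<in> P. x \<in> {fst p..fst p + 1}}. {fst p<..<fst p + 1})"
    have "open N" unfolding N_def using P by (intro open_INT) auto
    then have "open (N \<times> interior ?V)" by (intro open_Times) auto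
    moreover have "N \<times> interior ?V \<subseteq> ?U"
    proof safe
      fix x' z assume x': "x' \<in> N" and "z \<in> interior ?V"
      then have "(x, z) \<in> ?U" using interior_subset by blast
      then obtain p where p: "p \<in> P" "x \<in> {fst p..fst p + 1}" "z \<in> {snd p..snd p + 1}"
        unfolding unit_squares_def by auto
      then have "x' \<in> {fst p<..<fst p + 1}" using x' unfolding N_def by blast
      then show "(x', z) \<in> ?U"
        using p unfolding unit_squares_def by (intro UN_I[of p]) auto
    qed
    moreover have "x \<in> N"
      unfolding N_def
    proof
      fix p assume p: "p \<in> {p \<in> P. x \<in> {fst p..fst p + 1}}"
      then have "x \<noteq> fst p" "x \<noteq> fst p + 1" using x by blast+
      then show "x \<in> {fst p<..<fst p + 1}" using p by auto
    qed
    ultimately have "(x, y) \<in> interior ?U"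
      using \<open>y \<in> interior ?V\<close> by (intro interiorI) auto
    then show False using xy by (simp add: frontier_def)
  qed
  then show ?thesis using subsetD[OF closure_subset y] unfolding frontier_def by blast
qed

text \<open>
  With \<open>Y\<close> the ordinates of the horizontal sides, this bounds the length of the horizontal part
  of the boundary. The sum over \<open>y\<close> of the measures of the sets \<open>S y\<close> is the integral over
  \<open>x\<close> of the number of \<open>y\<close> with \<open>x \<in> S y\<close>, and these \<open>y\<close> are frontier points of the slice at \<open>x\<close>
  for almost every \<open>x\<close>.
\<close>

lemma horizontal_edges_le:
  assumes P: "finite P" and Y: "finite Y"
  shows "hausdorff_length (frontier (unit_squares P) \<inter> (UNIV \<times> Y)) \<le> 2 * area (unit_squares P)"
proof -
  let ?U = "unit_squares P"
  define S where "S y = fst ` (frontier ?U \<inter> (UNIV \<times> {y}))" for y :: real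
  have S_iff: "x \<in> S y \<longleftrightarrow> (x, y) \<in> frontier ?U" for x y by (force simp: S_def)
  have compU: "compact ?U" by (rule compact_unit_squares[OF P])
  have compS: "compact (S y)" for y unfolding S_def
    by (intro compact_continuous_image compact_Int_closed compact_frontier compU closed_Times
          continuous_intros closed_UNIV closed_singleton)
  have measS: "S y \<in> sets borel" for y using compS by (rule borel_compact)
  have measU: "?U \<in> sets borel" using compU by (rule borel_compact)
  have line: "hausdorff_length ((\<lambda>x. (x, y)) ` S y) \<le> emeasure lborel (S y)" for y
    by (rule order_trans[OF hausdorff_length_nonexpansive_image_le hausdorff_length_le_lborel])
      (simp_all add: dist_Pair_Pair compS)
  have "frontier ?U \<inter> (UNIV \<times> Y) = (\<Union>y\<in>Y. (\<lambda>x. (x, y)) ` S y)"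
    by (auto simp: S_iff)
  then have "hausdorff_length (frontier ?U \<inter> (UNIV \<times> Y)) \<le> (\<Sum>y\<in>Y. hausdorff_length ((\<lambda>x. (x, y)) ` S y))"
    using hausdorff_length_UN_le[OF Y] by simp
  also have "\<dots> \<le> (\<Sum>y\<in>Y. emeasure lborel (S y))"
    by (intro sum_mono line)
  also have "\<dots> = (\<Sum>y\<in>Y. \<integral>\<^sup>+x. indicator (S y) x \<partial>lborel)"
    using measS by simp
  also have "\<dots> = (\<integral>\<^sup>+x. (\<Sum>y\<in>Y. indicator (S y) x) \<partial>lborel)"
    using measS by (subst nn_integral_sum) auto
  also have "\<dots> \<le> (\<integral>\<^sup>+x. 2 * emeasure lborel (Pair x -` ?U) \<partial>lborel)"
  proof (rule nn_integral_mono_AE)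
    let ?X = "fst ` P \<union> (\<lambda>p. fst p + 1) ` P"
    have "AE x in lborel. x \<notin> ?X"
      using P by (intro AE_not_in finite_imp_null_set_lborel) auto
    then show "AE x in lborel. (\<Sum>y\<in>Y. indicator (S y) x) \<le> 2 * emeasure lborel (Pair x -` ?U)"
    proof eventually_elim
      case (elim x)
      let ?V = "Pair x -` ?U"
      have fin: "finite (snd ` {p \<in> P. x \<in> {fst p..fst p + 1}})"
        using P by (auto intro: finite_subset[of _ P])
      have "(\<Sum>y\<in>Y. indicator (S y) x) = (of_nat (card {y \<in> Y. x \<in> S y}) :: ennreal)"
        using Y by (simp add: indicator_def sum.If_cases Int_def)
      also have "\<dots> \<le> of_nat (card (frontier ?V))"
        using frontier_slice[OF P elim] frontier_unit_intervals(1)[OF fin]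
        by (intro of_nat_mono card_mono) (auto simp: Pair_vimage_unit_squares S_iff)
      also have "\<dots> \<le> 2 * emeasure lborel ?V"
        using frontier_unit_intervals(2)[OF fin] by (simp add: Pair_vimage_unit_squares)
      finally show ?case .
    qed
  qed
  also have "\<dots> = 2 * emeasure (lborel \<Otimes>\<^sub>M lborel) ?U"
  proof -
    have U: "?U \<in> sets (lborel \<Otimes>\<^sub>M lborel)" using measU unfolding lborel_prod by simp
    show ?thesis
      using lborel.measurable_emeasure_Pair[OF U]
      by (simp add: lborel.emeasure_pair_measure_alt[OF U] nn_integral_cmult)
  qed
  also have "\<dots> = 2 * area ?U"
    using measU by (simp add: area_def lborel_prod)
  finally show ?thesis .
qed

lemma swap_unit_squares: "prod.swap ` unit_squares P = unit_squares (prod.swap ` P)"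
  by (simp add: unit_squares_def image_UN product_swap)

lemma area_swap_unit_squares:
  assumes P: "finite P"
  shows "area (unit_squares (prod.swap ` P)) = area (unit_squares P)"
proof -
  let ?M = "lborel \<Otimes>\<^sub>M lborel :: (real \<times> real) measure"
  have borel: "unit_squares Q \<in> sets borel" if "finite Q" for Q
    using compact_unit_squares[OF that] by (rule borel_compact)
  then have meas: "unit_squares Q \<in> sets ?M" if "finite Q" for Q
    unfolding lborel_prod using that by simp
  have area: "area (unit_squares Q) = emeasure ?M (unit_squares Q)" if "finite Q" for Q
    unfolding lborel_prod using borel[OF that] by (simp add: area_def)
  have "emeasure ?M (unit_squares (prod.swap ` P)) =
      emeasure (distr ?M ?M (\<lambda>(x, y). (y, x))) (unit_squares (prod.swap ` P))"
    by (rule arg_cong[OF lborel_pair.distr_pair_swap, of "\<lambda>N. emeasure N _"])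
  also have "\<dots> = emeasure ?M ((\<lambda>(x, y). (y, x)) -` unit_squares (prod.swap ` P) \<inter> space ?M)"
    using P meas by (intro emeasure_distr measurable_pair_swap') auto
  also have "(\<lambda>(x, y). (y, x)) -` unit_squares (prod.swap ` P) \<inter> space ?M = unit_squares P"
    by (auto simp: unit_squares_def space_pair_measure)
  finally show ?thesis using P by (simp add: area)
qed

text \<open>
  The coordinate swap is an isometry and a homeomorphism that preserves area and turns vertical
  lines into horizontal ones.
\<close>

lemma vertical_edges_le:
  assumes P: "finite P" and X: "finite X"
  shows "hausdorff_length (frontier (unit_squares P) \<inter> (X \<times> UNIV)) \<le> 2 * area (unit_squares P)"
proof -
  let ?U = "unit_squares P" and ?U' = "unit_squares (prod.swap ` P)"
  have lin: "linear (prod.swap :: real \<times> real \<Rightarrow> _)" by (intro linearI) auto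
  have closed: "closed (unit_squares Q)" if "finite Q" for Q
    using compact_unit_squares[OF that] by (rule compact_imp_closed)
  have "prod.swap ` frontier ?U = frontier ?U'"
    using interior_bijective_linear_image[OF lin bij_swap, of ?U] closed[of P] closed[of "prod.swap ` P"] P
    by (simp add: frontier_def swap_unit_squares image_set_diff)
  then have "frontier ?U \<inter> (X \<times> UNIV) = prod.swap ` (frontier ?U' \<inter> (UNIV \<times> X))"
    by force
  also have "hausdorff_length \<dots> \<le> hausdorff_length (frontier ?U' \<inter> (UNIV \<times> X))"
    by (rule hausdorff_length_nonexpansive_image_le) (auto simp: dist_prod_def add.commute)
  also have "\<dots> \<le> 2 * area ?U'"
    using P X by (intro horizontal_edges_le) auto
  finally show ?thesis by (simp add: area_swap_unit_squares P)
qed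

lemma frontier_unit_squares_subset:
  assumes P: "finite P"
  shows "frontier (unit_squares P) \<subseteq>
    UNIV \<times> (snd ` P \<union> (\<lambda>p. snd p + 1) ` P) \<union> (fst ` P \<union> (\<lambda>p. fst p + 1) ` P) \<times> UNIV"
    (is "_ \<subseteq> ?E")
proof (rule subsetI, rule ccontr)
  fix q assume q: "q \<in> frontier (unit_squares P)" "q \<notin> ?E"
  obtain x y where xy_q: "q = (x, y)" by (cases q)
  have xy: "(x, y) \<in> frontier (unit_squares P)"
    and nx: "x \<notin> fst ` P" "x \<notin> (\<lambda>p. fst p + 1) ` P"
    and ny: "y \<notin> (\<lambda>p. snd p + 1) ` P" "y \<notin> snd ` P"
    using q unfolding xy_q by blast+
  have "closed (unit_squares P)" using compact_unit_squares[OF P] by (rule compact_imp_closed)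
  then have "(x, y) \<in> unit_squares P" using xy frontier_subset_eq by blast
  then obtain p where p: "p \<in> P" "x \<in> {fst p..fst p + 1}" "y \<in> {snd p..snd p + 1}"
    unfolding unit_squares_def by auto
  moreover have "x \<noteq> fst p" "x \<noteq> fst p + 1" "y \<noteq> snd p" "y \<noteq> snd p + 1"
    using p(1) nx ny by blast+
  ultimately have "(x, y) \<in> {fst p<..<fst p + 1} \<times> {snd p<..<snd p + 1}" by auto
  moreover have "{fst p<..<fst p + 1} \<times> {snd p<..<snd p + 1} \<subseteq> unit_squares P"
    using p(1) unfolding unit_squares_def by (intro subsetI UN_I[of p]) auto
  ultimately have "(x, y) \<in> interior (unit_squares P)"
    by (intro interiorI[of "{fst p<..<fst p + 1} \<times> {snd p<..<snd p + 1}"] open_Times) auto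
  then show False using xy by (simp add: frontier_def)
qed

lemma perimeter_unit_squares_le:
  assumes P: "finite P"
  shows "perimeter (unit_squares P) \<le> 4 * area (unit_squares P)"
proof -
  let ?F = "frontier (unit_squares P)"
  let ?X = "fst ` P \<union> (\<lambda>p. fst p + 1) ` P" and ?Y = "snd ` P \<union> (\<lambda>p. snd p + 1) ` P"
  have "perimeter (unit_squares P) \<le> hausdorff_length (?F \<inter> (UNIV \<times> ?Y) \<union> ?F \<inter> (?X \<times> UNIV))"
    unfolding perimeter_def using frontier_unit_squares_subset[OF P]
    by (intro hausdorff_length_mono) auto
  also have "\<dots> \<le> hausdorff_length (?F \<inter> (UNIV \<times> ?Y)) + hausdorff_length (?F \<inter> (?X \<times> UNIV))"
    by (rule hausdorff_length_Un_le)
  also have "\<dots> \<le> 2 * area (unit_squares P) + 2 * area (unit_squares P)"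
    using P by (intro add_mono horizontal_edges_le vertical_edges_le) auto
  also have "\<dots> = 4 * area (unit_squares P)"
    by (simp flip: distrib_right)
  finally show ?thesis .
qed

theorem theorem1:
  fixes n :: nat and H :: "nat \<Rightarrow> (real \<times> real) set"
  assumes "n \<ge> 1"
    and "\<And>i. i \<in> {1..n} \<Longrightarrow> axis_parallel_unit_square (H i)"
  shows "perimeter (\<Union>i\<in>{1..n}. H i) / area (\<Union>i\<in>{1..n}. H i) \<le> 4"
proof -
  have "\<forall>i\<in>{1..n}. \<exists>p. H i = {fst p..fst p + 1} \<times> {snd p..snd p + 1}"
    using assms(2) unfolding axis_parallel_unit_square_def by force
  then obtain c where c: "\<And>i. i \<in> {1..n} \<Longrightarrow> H i = {fst (c i)..fst (c i) + 1} \<times> {snd (c i)..snd (c i) + 1}"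
    by metis
  define P where "P = c ` {1..n}"
  have U: "(\<Union>i\<in>{1..n}. H i) = unit_squares P"
    using c unfolding unit_squares_def P_def by simp
  have "finite P" by (simp add: P_def)
  then have *: "perimeter (unit_squares P) \<le> 4 * area (unit_squares P)"
    by (rule perimeter_unit_squares_le)
  show ?thesis
  proof (unfold U, cases "area (unit_squares P) = 0")
    case True
    \<comment> \<open>Then the perimeter is 0 as well, and \<open>0 / 0 = 0\<close>.\<close>
    then show "perimeter (unit_squares P) / area (unit_squares P) \<le> 4"
      using * by (simp add: divide_ennreal_def)
  next
    case False
    then show "perimeter (unit_squares P) / area (unit_squares P) \<le> 4"
      using * by (intro divide_le_posI_ennreal) (auto simp: zero_less_iff_neq_zero mult.commute)
  qed
qed

end
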